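(* Let $(A,\succ,\prec)$ be an anti-dendriform algebra and let $r=\sum_i a_i\otimes b_i\in A\otimes A$ be skew-symmetric. Then the following conditions are equivalent: (a) $r$ is a solution of the anti-dendriform Yang-Baxter equation, that is, $r_{12}\cdot r_{13}+r_{23}\succ r_{12}-r_{13}\prec r_{23}=0$. (b) For all $u^*,v^*\in A^*$, $$T_r(u^* )\cdot T_r(v^* )+T_r\big(R_{\prec}^*(T_r(u^* ))v^*+L_{\succ}^*(T_r(v^* ))u^*\big)=0.$$
   Context: All vector spaces and algebras are over a field $k$, and all algebras are finite-dimensional. An anti-dendriform algebra $(A,\succ,\prec)$ is a vector space with two bilinear maps $\succ,\prec:A\times A\to A$ such that, writing $x\cdot y=x\succ y+x\prec y$, for all $x,y,z$: $x\succ(y\succ z)=-(x\cdot y)\succ z=-x\prec(y\cdot z)=(x\prec y)\prec z$ and $(x\succ y)\prec z=x\succ(y\prec z)$. $r=\sum_i a_i\otimes b_i$ is skew-symmetric if $\sum_i b_i\otimes a_i=-r$. Notation: $r_{12}\cdot r_{13}=\sum_{i,j}(a_i\cdot a_j)\otimes b_i\otimes b_j$, $r_{23}\succ r_{12}=\sum_{i,j}a_i\otimes(a_j\succ b_i)\otimes b_j$, $r_{13}\prec r_{23}=\sum_{i,j}a_i\otimes a_j\otimes(b_i\prec b_j)$. The map $T_r:A^*\to A$ is $T_r(w^* )=\sum_i\langle w^*,a_i\rangle b_i$. $L_{\succ}(x)y=x\succ y$, $R_{\prec}(x)y=y\prec x$, and $L_{\succ}^*,R_{\prec}^*:A\to\mathrm{End}(A^*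 )$ are defined by $\langle L_{\succ}^*(x)u^*,v\rangle=\langle u^*,L_{\succ}(x)v\rangle$, $\langle R_{\prec}^*(x)u^*,v\rangle=\langle u^*,R_{\prec}(x)v\rangle$ (no sign). *)

theory Defs
  imports Complex_Main "HOL-Library.Poly_Mapping"
begin

locale anti_dendriform_algebra = vector_space scale
  for scale :: "'k::field \<Rightarrow> 'a::ab_group_add \<Rightarrow> 'a" +
  fixes succ :: "'a \<Rightarrow> 'a \<Rightarrow> 'a"  (infixl "\<succ>" 70)
    and prec :: "'a \<Rightarrow> 'a \<Rightarrow> 'a"  (infixl "\<prec>" 70)
  assumes finite_dimensional: "\<exists>B. finite_dimensional_vector_space scale B"
    and linear_succ_right: "Vector_Spaces.linear scale scale (\<lambda>y. x \<succ> y)"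
    and linear_succ_left: "Vector_Spaces.linear scale scale (\<lambda>x. x \<succ> y)"
    and linear_prec_right: "Vector_Spaces.linear scale scale (\<lambda>y. x \<prec> y)"
    and linear_prec_left: "Vector_Spaces.linear scale scale (\<lambda>x. x \<prec> y)"
    and succ_succ: "x \<succ> (y \<succ> z) = - ((x \<succ> y + x \<prec> y) \<succ> z)"
    and succ_prec: "- ((x \<succ> y + x \<prec> y) \<succ> z) = - (x \<prec> (y \<succ> z + y \<prec> z))"
    and prec_prec: "- (x \<prec> (y \<succ> z + y \<prec> z)) = (x \<prec> y) \<prec> z"
    and succ_prec_assoc: "(x \<succ> y) \<prec> z = x \<succ> (y \<prec> z)"

definition assoc_prod :: "('a \<Rightarrow> 'a \<Rightarrow> 'a) \<Rightarrow> ('a \<Rightarrow> 'a \<Rightarrow> 'a) \<Rightarrow> 'a \<Rightarrow> 'a \<Rightarrow> 'a::plus"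
  where "assoc_prod succ prec x y = succ x y + prec x y"

definition dual_space :: "('k::field \<Rightarrow> 'a::ab_group_add \<Rightarrow> 'a) \<Rightarrow> ('a \<Rightarrow> 'k) set"
  where "dual_space scale = {u. Vector_Spaces.linear scale (*) u}"

definition Lmult :: "('a \<Rightarrow> 'a \<Rightarrow> 'a) \<Rightarrow> 'a \<Rightarrow> 'a \<Rightarrow> 'a"
  where "Lmult m x y = m x y"

definition Rmult :: "('a \<Rightarrow> 'a \<Rightarrow> 'a) \<Rightarrow> 'a \<Rightarrow> 'a \<Rightarrow> 'a"
  where "Rmult m x y = m y x"

text \<open>The transpose of an operator, without sign: the pairing of \<open>dual_op F x u\<close> with \<open>v\<close> is
  the pairing of \<open>u\<close> with \<open>F x v\<close>.\<close>

definition dual_op :: "('a \<Rightarrow> 'a \<Rightarrow> 'a) \<Rightarrow> 'a \<Rightarrow> ('a \<Rightarrow> 'k) \<Rightarrow> ('a \<Rightarrow> 'k)"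
  where "dual_op F x u = (\<lambda>v. u (F x v))"

text \<open>The free vector space on a type \<open>'b\<close> is the type \<open>'b \<Rightarrow>\<^sub>0 'k\<close> of finitely supported functions.
  The tensor products \<open>A \<otimes> A\<close> and \<open>A \<otimes> A \<otimes> A\<close> are its quotients (for \<open>'b = 'a \<times> 'a\<close> and
  \<open>'b = 'a \<times> 'a \<times> 'a\<close>) by the subspace spanned by the multilinearity relations;
  \<open>tensor2\<close> and \<open>tensor3\<close> are the quotient maps, with cosets as values.\<close>

definition free_scale :: "'k::field \<Rightarrow> ('b \<Rightarrow>\<^sub>0 'k) \<Rightarrow> ('b \<Rightarrow>\<^sub>0 'k)"
  where "free_scale c f = Poly_Mapping.map ((*) c) f"

lemma lookup_free_scale: "Poly_Mapping.lookup (free_scale c f) x = c * Poly_Mapping.lookup f x"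
  by (simp add: free_scale_def Poly_Mapping.map.rep_eq when_def)

lemma vector_space_free_scale: "vector_space free_scale"
  by unfold_locales
    (auto intro!: poly_mapping_eqI simp: lookup_free_scale lookup_add algebra_simps)

abbreviation gen :: "'b \<Rightarrow> ('b \<Rightarrow>\<^sub>0 'k::field)"
  where "gen x \<equiv> Poly_Mapping.single x 1"

definition tensor2_rels :: "('k::field \<Rightarrow> 'a::ab_group_add \<Rightarrow> 'a) \<Rightarrow> ('a \<times> 'a \<Rightarrow>\<^sub>0 'k) set"
  where "tensor2_rels scale =
      {gen (x + x', y) - gen (x, y) - gen (x', y) | x x' y. True}
    \<union> {gen (x, y + y') - gen (x, y) - gen (x, y') | x y y'. True}
    \<union> {gen (scale c x, y) - free_scale c (gen (x, y)) | c x y. True}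
    \<union> {gen (x, scale c y) - free_scale c (gen (x, y)) | c x y. True}"

definition tensor3_rels :: "('k::field \<Rightarrow> 'a::ab_group_add \<Rightarrow> 'a) \<Rightarrow> ('a \<times> 'a \<times> 'a \<Rightarrow>\<^sub>0 'k) set"
  where "tensor3_rels scale =
      {gen (x + x', y, z) - gen (x, y, z) - gen (x', y, z) | x x' y z. True}
    \<union> {gen (x, y + y', z) - gen (x, y, z) - gen (x, y', z) | x y y' z. True}
    \<union> {gen (x, y, z + z') - gen (x, y, z) - gen (x, y, z') | x y z z'. True}
    \<union> {gen (scale c x, y, z) - free_scale c (gen (x, y, z)) | c x y z. True}
    \<union> {gen (x, scale c y, z) - free_scale c (gen (x, y, z)) | c x y z. True}
    \<union> {gen (x, y, scale c z) - free_scale c (gen (x, y, z)) | c x y z. True}"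

definition tensor2 ::
  "('k::field \<Rightarrow> 'a::ab_group_add \<Rightarrow> 'a) \<Rightarrow> ('a \<times> 'a \<Rightarrow>\<^sub>0 'k) \<Rightarrow> ('a \<times> 'a \<Rightarrow>\<^sub>0 'k) set"
  where "tensor2 scale f = {g. g - f \<in> module.span free_scale (tensor2_rels scale)}"

definition tensor3 ::
  "('k::field \<Rightarrow> 'a::ab_group_add \<Rightarrow> 'a) \<Rightarrow> ('a \<times> 'a \<times> 'a \<Rightarrow>\<^sub>0 'k) \<Rightarrow> ('a \<times> 'a \<times> 'a \<Rightarrow>\<^sub>0 'k) set"
  where "tensor3 scale f = {g. g - f \<in> module.span free_scale (tensor3_rels scale)}"

lemma free_coset_eq_iff:
  fixes f g :: "'b \<Rightarrow>\<^sub>0 'k::field"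
  shows "{h. h - f \<in> module.span free_scale S} = {h. h - g \<in> module.span free_scale S}
    \<longleftrightarrow> f - g \<in> module.span free_scale S"
proof -
  interpret vector_space "free_scale :: 'k \<Rightarrow> ('b \<Rightarrow>\<^sub>0 'k) \<Rightarrow> _"
    by (rule vector_space_free_scale)
  show ?thesis
  proof
    assume eq: "{h. h - f \<in> span S} = {h. h - g \<in> span S}"
    have "f \<in> {h. h - f \<in> span S}" by (simp add: span_zero)
    with eq show "f - g \<in> span S" by blast
  next
    assume fg: "f - g \<in> span S"
    have "h - f \<in> span S \<longleftrightarrow> h - g \<in> span S" for h
      using span_add[OF _ fg, of "h - f"] span_diff[OF _ fg, of "h - g"] by auto
    then show "{h. h - f \<in> span S} = {h. h - g \<in> span S}" by blast
  qed
qed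

lemma tensor2_eq_iff:
  "tensor2 scale f = tensor2 scale g \<longleftrightarrow> f - g \<in> module.span free_scale (tensor2_rels scale)"
  unfolding tensor2_def by (rule free_coset_eq_iff)

lemma tensor3_eq_iff:
  "tensor3 scale f = tensor3 scale g \<longleftrightarrow> f - g \<in> module.span free_scale (tensor3_rels scale)"
  unfolding tensor3_def by (rule free_coset_eq_iff)

text \<open>A tensor \<open>r = (\<Sum>i\<in>I. a i \<otimes> b i)\<close> is given by a finite index set \<open>I\<close> and families \<open>a\<close>, \<open>b\<close>.
  Every element of \<open>A \<otimes> A\<close> has this form, scalar coefficients being absorbed into \<open>a\<close>.\<close>

definition skew_symmetric_tensor ::
  "('k::field \<Rightarrow> 'a::ab_group_add \<Rightarrow> 'a) \<Rightarrow> 'i set \<Rightarrow> ('i \<Rightarrow> 'a) \<Rightarrow> ('i \<Rightarrow> 'a) \<Rightarrow> bool"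
  where "skew_symmetric_tensor scale I a b \<longleftrightarrow>
    tensor2 scale (\<Sum>i\<in>I. gen (b i, a i)) = tensor2 scale (- (\<Sum>i\<in>I. gen (a i, b i)))"

text \<open>Representatives of \<open>r\<^sub>1\<^sub>2 \<cdot> r\<^sub>1\<^sub>3\<close>, \<open>r\<^sub>2\<^sub>3 \<cdot> r\<^sub>1\<^sub>2\<close> and \<open>r\<^sub>1\<^sub>3 \<cdot> r\<^sub>2\<^sub>3\<close> for an arbitrary
  product \<open>m\<close> on \<open>A\<close>.\<close>

definition r12_r13 ::
  "('a \<Rightarrow> 'a \<Rightarrow> 'a) \<Rightarrow> 'i set \<Rightarrow> ('i \<Rightarrow> 'a) \<Rightarrow> ('i \<Rightarrow> 'a) \<Rightarrow> ('a \<times> 'a \<times> 'a \<Rightarrow>\<^sub>0 'k::field)"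
  where "r12_r13 m I a b = (\<Sum>i\<in>I. \<Sum>j\<in>I. gen (m (a i) (a j), b i, b j))"

definition r23_r12 ::
  "('a \<Rightarrow> 'a \<Rightarrow> 'a) \<Rightarrow> 'i set \<Rightarrow> ('i \<Rightarrow> 'a) \<Rightarrow> ('i \<Rightarrow> 'a) \<Rightarrow> ('a \<times> 'a \<times> 'a \<Rightarrow>\<^sub>0 'k::field)"
  where "r23_r12 m I a b = (\<Sum>i\<in>I. \<Sum>j\<in>I. gen (a i, m (a j) (b i), b j))"

definition r13_r23 ::
  "('a \<Rightarrow> 'a \<Rightarrow> 'a) \<Rightarrow> 'i set \<Rightarrow> ('i \<Rightarrow> 'a) \<Rightarrow> ('i \<Rightarrow> 'a) \<Rightarrow> ('a \<times> 'a \<times> 'a \<Rightarrow>\<^sub>0 'k::field)"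
  where "r13_r23 m I a b = (\<Sum>i\<in>I. \<Sum>j\<in>I. gen (a i, a j, m (b i) (b j)))"

definition anti_dendriform_YBE ::
  "('k::field \<Rightarrow> 'a::ab_group_add \<Rightarrow> 'a) \<Rightarrow> ('a \<Rightarrow> 'a \<Rightarrow> 'a) \<Rightarrow> ('a \<Rightarrow> 'a \<Rightarrow> 'a) \<Rightarrow>
    'i set \<Rightarrow> ('i \<Rightarrow> 'a) \<Rightarrow> ('i \<Rightarrow> 'a) \<Rightarrow> bool"
  where "anti_dendriform_YBE scale succ prec I a b \<longleftrightarrow>
    tensor3 scale (r12_r13 (assoc_prod succ prec) I a b + r23_r12 succ I a b - r13_r23 prec I a b)
      = tensor3 scale 0"

definition T_map ::
  "('k::field \<Rightarrow> 'a::ab_group_add \<Rightarrow> 'a) \<Rightarrow> 'i set \<Rightarrow> ('i \<Rightarrow> 'a) \<Rightarrow> ('i \<Rightarrow> 'a) \<Rightarrow> ('a \<Rightarrow> 'k) \<Rightarrow> 'a"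
  where "T_map scale I a b w = (\<Sum>i\<in>I. scale (w (a i)) (b i))"

end

theory Submission
  imports Defs
begin

text \<open>
  Write \<open>T\<close> for \<open>T_map scale I a b\<close>, and \<open>LHS u v\<close> for the left-hand side of the operator identity.
  The idea is to test both conditions against linear functionals.

  Pairing \<open>w \<otimes> u \<otimes> v\<close> with a term such as \<open>r\<^sub>1\<^sub>2 \<cdot> r\<^sub>1\<^sub>3\<close> contracts each tensor leg that is not
  multiplied, and so inserts values of \<open>T\<close> or of its transpose \<open>T_map scale I b a\<close> into the product
  (\<open>pairing_r12_r13\<close>, \<open>pairing_r23_r12\<close>, \<open>pairing_r13_r23\<close>). Skew-symmetry of \<open>r\<close> says that the
  transpose is \<open>- T\<close> (\<open>T_map_transpose_skew\<close>). The pairing of \<open>w \<otimes> u \<otimes> v\<close> with the Yang-Baxter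
  tensor is therefore
  \<open>w (T u \<cdot> T v) - u (T v \<succ> T w) - v (T w \<prec> T u)\<close>.
  On the other side, \<open>w (T f) = - f (T w)\<close> for every functional \<open>f\<close>, again by skew-symmetry; with
  \<open>f = R\<^sub>\<prec>\<^sup>* (T u) v + L\<^sub>\<succ>\<^sup>* (T v) u\<close> this shows that \<open>w (LHS u v)\<close> is the same scalar.

  It remains to know that functionals detect zero, in \<open>A\<close> (\<open>functionals_separate\<close>) and in
  \<open>A \<otimes> A \<otimes> A\<close> (\<open>tensor3_zero_iff_pairings\<close>). Both come from the coordinates with respect to a
  basis. For the tensor power, presented by generators and relations, the point is that modulo the
  relations every element is the combination of the basis tensors \<open>p \<otimes> q \<otimes> s\<close> whose coefficients
  are its pairings with products of coordinate functionals.
\<close>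

section \<open>Linear extension from the free vector space\<close>

definition lin_ext :: "('k::field \<Rightarrow> 'v::ab_group_add \<Rightarrow> 'v) \<Rightarrow> ('b \<Rightarrow> 'v) \<Rightarrow> ('b \<Rightarrow>\<^sub>0 'k) \<Rightarrow> 'v"
  where "lin_ext s \<phi> f = (\<Sum>x\<in>Poly_Mapping.keys f. s (Poly_Mapping.lookup f x) (\<phi> x))"

lemma lin_ext_superset:
  assumes "vector_space s" "finite K" "Poly_Mapping.keys f \<subseteq> K"
  shows "lin_ext s \<phi> f = (\<Sum>x\<in>K. s (Poly_Mapping.lookup f x) (\<phi> x))"
proof -
  interpret vector_space s by fact
  show ?thesis
    unfolding lin_ext_def using assms(2,3)
    by (intro sum.mono_neutral_left) (auto simp: in_keys_iff)
qed

lemma linear_lin_ext: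
  assumes "vector_space s"
  shows "Vector_Spaces.linear free_scale s (lin_ext s \<phi>)"
proof -
  interpret vector_space s by fact
  have "lin_ext s \<phi> (f + g) = lin_ext s \<phi> f + lin_ext s \<phi> g" for f g
  proof -
    let ?K = "Poly_Mapping.keys f \<union> Poly_Mapping.keys g"
    have "Poly_Mapping.keys (f + g) \<subseteq> ?K" by (rule keys_add)
    then show ?thesis
      by (simp add: lin_ext_superset[OF assms, of ?K] lookup_add scale_left_distrib sum.distrib)
  qed
  moreover have "lin_ext s \<phi> (free_scale c f) = s c (lin_ext s \<phi> f)" for c f
  proof -
    have "Poly_Mapping.keys (free_scale c f) \<subseteq> Poly_Mapping.keys f"
      by (auto simp: in_keys_iff lookup_free_scale)
    then show ?thesis
      by (simp add: lin_ext_superset[OF assms, of "Poly_Mapping.keys f"] lookup_free_scale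
          scale_sum_right)
  qed
  ultimately show ?thesis
    using assms vector_space_free_scale
    by (intro module_hom_iff_linear[THEN iffD1] module_hom.intro module_hom_axioms.intro)
      (auto simp: module_iff_vector_space)
qed

lemmas module_hom_lin_ext = linear_lin_ext[unfolded linear_iff_module_hom]

lemma lin_ext_gen:
  assumes "vector_space s"
  shows "lin_ext s \<phi> (gen x) = \<phi> x"
proof -
  interpret vector_space s by fact
  show ?thesis by (simp add: lin_ext_def)
qed

lemmas lin_ext_simps =
  lin_ext_gen module_hom.add[OF module_hom_lin_ext] module_hom.diff[OF module_hom_lin_ext]
  module_hom.scale[OF module_hom_lin_ext] module_hom.sum[OF module_hom_lin_ext]
  module_hom.neg[OF module_hom_lin_ext]

lemma lin_ext_eq_0_on_span:
  assumes "vector_space s" "f \<in> module.span free_scale S" "\<And>g. g \<in> S \<Longrightarrow> lin_ext s \<phi> g = 0"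
  shows "lin_ext s \<phi> f = 0"
  using module_hom.eq_0_on_span[OF module_hom_lin_ext[OF assms(1)]] assms(2,3) by blast

text \<open>If \<open>\<psi> x\<close> is a normal form of the generator \<open>x\<close> modulo the relations \<open>S\<close>, then extending \<open>\<psi>\<close>
  linearly computes a normal form of every element.\<close>

lemma lin_ext_congruent:
  fixes \<psi> :: "'b \<Rightarrow> ('b \<Rightarrow>\<^sub>0 'k::field)"
  assumes "\<And>x. gen x - \<psi> x \<in> module.span free_scale S"
  shows "f - lin_ext free_scale \<psi> f \<in> module.span free_scale S"
proof -
  interpret vector_space "free_scale :: 'k \<Rightarrow> ('b \<Rightarrow>\<^sub>0 'k) \<Rightarrow> _"
    by (rule vector_space_free_scale)
  have f: "f = (\<Sum>x\<in>Poly_Mapping.keys f. free_scale (Poly_Mapping.lookup f x) (gen x))"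
    by (rule poly_mapping_eqI)
      (auto simp: lookup_sum lookup_free_scale lookup_single when_def in_keys_iff
        if_distrib sum.delta cong: if_cong)
  have "f - lin_ext free_scale \<psi> f
      = (\<Sum>x\<in>Poly_Mapping.keys f. free_scale (Poly_Mapping.lookup f x) (gen x - \<psi> x))"
    by (subst (1) f) (simp add: lin_ext_def scale_right_diff_distrib sum_subtractf)
  also have "\<dots> \<in> span S"
    by (intro span_sum span_scale assms)
  finally show ?thesis .
qed

section \<open>Zero is detected by functionals\<close>

lemma vector_space_field: "vector_space ((*) :: 'k::field \<Rightarrow> 'k \<Rightarrow> 'k)"
  by unfold_locales (auto simp: algebra_simps)

lemma dual_spaceD:
  assumes "u \<in> dual_space scale"
  shows dual_add: "u (x + y) = u x + u y"
    and dual_diff: "u (x - y) = u x - u y"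
    and dual_neg: "u (- x) = - u x"
    and dual_zero: "u 0 = 0"
    and dual_scale: "u (scale c x) = c * u x"
    and dual_sum: "u (sum g K) = (\<Sum>i\<in>K. u (g i))"
proof -
  interpret module_hom scale "(*)" u
    using assms by (simp add: dual_space_def linear_iff_module_hom)
  show "u (x + y) = u x + u y" "u (x - y) = u x - u y" "u (- x) = - u x" "u 0 = 0"
    "u (scale c x) = c * u x" "u (sum g K) = (\<Sum>i\<in>K. u (g i))"
    by (auto simp: add diff neg scale sum)
qed

text \<open>A tensor slot \<open>x \<mapsto> gen (x, y, z)\<close> is not linear in the free space, only modulo the span of the
  relations; this is enough to expand the slot in a basis.\<close>

lemma congruence_linear_combination:
  fixes g :: "'a::ab_group_add \<Rightarrow> ('b \<Rightarrow>\<^sub>0 'k::field)"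
  assumes "vector_space scale" "finite K"
    and add: "\<And>x x'. g (x + x') - g x - g x' \<in> module.span free_scale S"
    and scale: "\<And>c x. g (scale c x) - free_scale c (g x) \<in> module.span free_scale S"
  shows "g (\<Sum>p\<in>K. scale (c p) p) - (\<Sum>p\<in>K. free_scale (c p) (g p)) \<in> module.span free_scale S"
  using assms(2)
proof induction
  case empty
  interpret F: vector_space "free_scale :: 'k \<Rightarrow> ('b \<Rightarrow>\<^sub>0 'k) \<Rightarrow> _"
    by (rule vector_space_free_scale)
  interpret vector_space scale by fact
  show ?case using scale[of 0 0] by simp
next
  case (insert p K)
  interpret F: vector_space "free_scale :: 'k \<Rightarrow> ('b \<Rightarrow>\<^sub>0 'k) \<Rightarrow> _"
    by (rule vector_space_free_scale)
  let ?x = "scale (c p) p" and ?y = "\<Sum>p\<in>K. scale (c p) p"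
  have "(g (?x + ?y) - g ?x - g ?y) + (g ?x - free_scale (c p) (g p))
      + (g ?y - (\<Sum>p\<in>K. free_scale (c p) (g p))) \<in> F.span S"
    by (intro F.span_add add scale insert.IH)
  then show ?case using insert.hyps by (simp add: algebra_simps)
qed

context finite_dimensional_vector_space
begin

lemma coordinate_in_dual: "(\<lambda>x. representation Basis x p) \<in> dual_space scale"
  unfolding dual_space_def mem_Collect_eq
  by (rule linear_representation) (simp_all add: independent_Basis span_Basis)

lemma coordinate_expansion: "(\<Sum>p\<in>Basis. scale (representation Basis x p) p) = x"
  by (rule sum_representation_eq) (simp_all add: independent_Basis span_Basis finite_Basis)

lemma functionals_separate:
  assumes "\<And>w. w \<in> dual_space scale \<Longrightarrow> w x = 0"
  shows "x = 0"
  using coordinate_expansion[of x] assms[OF coordinate_in_dual] by simp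

end

abbreviation pairing3 ::
  "('a \<Rightarrow> 'k::field) \<Rightarrow> ('a \<Rightarrow> 'k) \<Rightarrow> ('a \<Rightarrow> 'k) \<Rightarrow> ('a \<times> 'a \<times> 'a \<Rightarrow>\<^sub>0 'k) \<Rightarrow> 'k"
  where "pairing3 w u v \<equiv> lin_ext (*) (\<lambda>(x, y, z). w x * u y * v z)"

lemma pairing3_eq_0_on_relations:
  assumes "w \<in> dual_space scale" "u \<in> dual_space scale" "v \<in> dual_space scale"
    and "f \<in> module.span free_scale (tensor3_rels scale)"
  shows "pairing3 w u v f = 0"
proof (rule lin_ext_eq_0_on_span[OF vector_space_field assms(4)])
  fix g assume "g \<in> tensor3_rels scale"
  then show "pairing3 w u v g = 0"
    unfolding tensor3_rels_def
    by (safe; simp add: lin_ext_simps vector_space_field dual_spaceD[OF assms(1)]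
        dual_spaceD[OF assms(2)] dual_spaceD[OF assms(3)] algebra_simps)
qed

text \<open>The three slots are expanded one after the other: the local fact \<open>slot\<close> expands one slot and
  replaces each resulting generator by its own expansion, already known modulo the relations.\<close>

lemma (in finite_dimensional_vector_space) gen_expansion_mod_relations:
  defines "R \<equiv> representation Basis"
  shows "gen (x, y, z) - (\<Sum>p\<in>Basis. \<Sum>q\<in>Basis. \<Sum>s\<in>Basis.
      free_scale (R x p * R y q * R z s) (gen (p, q, s))) \<in> module.span free_scale (tensor3_rels scale)"
proof -
  interpret F: vector_space "free_scale :: 'a \<Rightarrow> ('b \<times> 'b \<times> 'b \<Rightarrow>\<^sub>0 'a) \<Rightarrow> _"
    by (rule vector_space_free_scale)
  let ?N = "F.span (tensor3_rels scale)"
  have slot: "g x - (\<Sum>p\<in>Basis. free_scale (R x p) (h p)) \<in> ?N"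
    if add: "\<And>x x'. g (x + x') - g x - g x' \<in> ?N"
      and scale: "\<And>c x. g (scale c x) - free_scale c (g x) \<in> ?N"
      and h: "\<And>p. g p - h p \<in> ?N" for g h x
  proof -
    have "g x - (\<Sum>p\<in>Basis. free_scale (R x p) (g p)) \<in> ?N"
      using congruence_linear_combination[OF vector_space_axioms finite_Basis add scale,
          where c = "R x"]
      by (simp add: R_def coordinate_expansion)
    moreover have "(\<Sum>p\<in>Basis. free_scale (R x p) (g p - h p)) \<in> ?N"
      by (intro F.span_sum F.span_scale h)
    ultimately have "(g x - (\<Sum>p\<in>Basis. free_scale (R x p) (g p)))
        + (\<Sum>p\<in>Basis. free_scale (R x p) (g p - h p)) \<in> ?N"
      by (rule F.span_add)
    then show ?thesis
      by (simp add: F.scale_right_diff_distrib sum_subtractf)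
  qed
  have rels_add: "gen (x + x', y, z) - gen (x, y, z) - gen (x', y, z) \<in> ?N"
      "gen (x, y + y', z) - gen (x, y, z) - gen (x, y', z) \<in> ?N"
      "gen (x, y, z + z') - gen (x, y, z) - gen (x, y, z') \<in> ?N" for x x' y y' z z'
    by (rule F.span_base, simp only: tensor3_rels_def Un_iff mem_Collect_eq, metis)+
  have rels_scale: "gen (scale c x, y, z) - free_scale c (gen (x, y, z)) \<in> ?N"
      "gen (x, scale c y, z) - free_scale c (gen (x, y, z)) \<in> ?N"
      "gen (x, y, scale c z) - free_scale c (gen (x, y, z)) \<in> ?N" for c x y z
    by (rule F.span_base, simp only: tensor3_rels_def Un_iff mem_Collect_eq, metis)+
  have z: "gen (p, q, z) - (\<Sum>s\<in>Basis. free_scale (R z s) (gen (p, q, s))) \<in> ?N" for p q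
    by (rule slot[where g = "\<lambda>z. gen (p, q, z)" and h = "\<lambda>s. gen (p, q, s)"])
      (rule rels_add rels_scale | simp add: F.span_zero)+
  have yz: "gen (p, y, z) - (\<Sum>q\<in>Basis. free_scale (R y q)
      (\<Sum>s\<in>Basis. free_scale (R z s) (gen (p, q, s)))) \<in> ?N" for p
    by (rule slot[where g = "\<lambda>y. gen (p, y, z)"
          and h = "\<lambda>q. \<Sum>s\<in>Basis. free_scale (R z s) (gen (p, q, s))"])
      (rule rels_add rels_scale z)+
  have "gen (x, y, z) - (\<Sum>p\<in>Basis. free_scale (R x p) (\<Sum>q\<in>Basis. free_scale (R y q)
      (\<Sum>s\<in>Basis. free_scale (R z s) (gen (p, q, s))))) \<in> ?N"
    by (rule slot[where g = "\<lambda>x. gen (x, y, z)" and h = "\<lambda>p. \<Sum>q\<in>Basis. free_scale (R y q)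
            (\<Sum>s\<in>Basis. free_scale (R z s) (gen (p, q, s)))"])
      (rule rels_add rels_scale yz)+
  then show ?thesis
    by (simp add: F.scale_sum_right mult.assoc)
qed

text \<open>The pairings are constant on cosets of the relations. Conversely, the coefficients of the
  normal form supplied by \<open>gen_expansion_mod_relations\<close> are pairings with coordinate functionals, so they vanish
  when all pairings do.\<close>

lemma (in finite_dimensional_vector_space) tensor3_zero_iff_pairings:
  "tensor3 scale f = tensor3 scale 0 \<longleftrightarrow>
    (\<forall>w\<in>dual_space scale. \<forall>u\<in>dual_space scale. \<forall>v\<in>dual_space scale. pairing3 w u v f = 0)"
proof
  assume "tensor3 scale f = tensor3 scale 0"
  then show "\<forall>w\<in>dual_space scale. \<forall>u\<in>dual_space scale. \<forall>v\<in>dual_space scale. pairing3 w u v f = 0"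
    by (simp add: tensor3_eq_iff pairing3_eq_0_on_relations)
next
  assume pair: "\<forall>w\<in>dual_space scale. \<forall>u\<in>dual_space scale. \<forall>v\<in>dual_space scale.
    pairing3 w u v f = 0"
  interpret F: vector_space "free_scale :: 'a \<Rightarrow> ('b \<times> 'b \<times> 'b \<Rightarrow>\<^sub>0 'a) \<Rightarrow> _"
    by (rule vector_space_free_scale)
  define R where "R = representation Basis"
  define \<psi> where "\<psi> = (\<lambda>(x, y, z). \<Sum>p\<in>Basis. \<Sum>q\<in>Basis. \<Sum>s\<in>Basis.
    free_scale (R x p * R y q * R z s) (gen (p, q, s) :: 'b \<times> 'b \<times> 'b \<Rightarrow>\<^sub>0 'a))"
  have "gen t - \<psi> t \<in> F.span (tensor3_rels scale)" for t
    unfolding \<psi>_def R_def by (cases t) (simp only: split gen_expansion_mod_relations)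
  then have "f - lin_ext free_scale \<psi> f \<in> F.span (tensor3_rels scale)"
    by (rule lin_ext_congruent)
  moreover have "lin_ext free_scale \<psi> f = 0"
  proof -
    have "lin_ext free_scale \<psi> f = (\<Sum>p\<in>Basis. \<Sum>q\<in>Basis. \<Sum>s\<in>Basis.
        free_scale (pairing3 (\<lambda>x. R x p) (\<lambda>x. R x q) (\<lambda>x. R x s) f) (gen (p, q, s)))"
      unfolding lin_ext_def \<psi>_def
      by (simp add: case_prod_beta F.scale_sum_right F.scale_sum_left
          sum.swap[where B = Basis and A = "Poly_Mapping.keys f"])
    also have "\<dots> = 0"
      using pair coordinate_in_dual unfolding R_def by simp
    finally show ?thesis .
  qed
  ultimately show "tensor3 scale f = tensor3 scale 0"
    by (simp add: tensor3_eq_iff)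
qed

section \<open>Skew-symmetry in terms of \<open>T\<close>\<close>

text \<open>The map \<open>x \<otimes> y \<mapsto> scale (u y) x\<close> is well defined on \<open>A \<otimes> A\<close>; it sends
  \<open>r\<close> to \<open>T_map scale I b a u\<close> and the flip of \<open>r\<close> to \<open>T u\<close>.\<close>

lemma T_map_transpose_skew:
  assumes "vector_space scale" "skew_symmetric_tensor scale I a b" "u \<in> dual_space scale"
  shows "T_map scale I b a u = - T_map scale I a b u"
proof -
  interpret vector_space scale by fact
  let ?\<phi> = "\<lambda>(x, y). scale (u y) x"
  let ?f = "(\<Sum>i\<in>I. gen (b i, a i)) - (- (\<Sum>i\<in>I. gen (a i, b i)))"
  have "?f \<in> module.span free_scale (tensor2_rels scale)"
    using assms(2) by (simp only: skew_symmetric_tensor_def tensor2_eq_iff)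
  then have "lin_ext scale ?\<phi> ?f = 0"
  proof (rule lin_ext_eq_0_on_span[OF assms(1)])
    fix g assume "g \<in> tensor2_rels scale"
    then show "lin_ext scale ?\<phi> g = 0"
      unfolding tensor2_rels_def
      by (safe; simp add: lin_ext_simps[OF assms(1)] dual_spaceD[OF assms(3)] algebra_simps)
  qed
  then have "T_map scale I a b u + T_map scale I b a u = 0"
    using assms(1) by (simp add: lin_ext_simps T_map_def)
  then show ?thesis by (simp add: eq_neg_iff_add_eq_0 add.commute)
qed

text \<open>So \<open>T_map scale I b a\<close> is the transpose of \<open>T_map scale I a b\<close>.\<close>

lemma dual_T_map:
  assumes "f \<in> dual_space scale" "w \<in> dual_space scale"
  shows "w (T_map scale I a b f) = f (T_map scale I b a w)"
  by (simp add: T_map_def dual_spaceD[OF assms(1)] dual_spaceD[OF assms(2)] mult.commute)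

section \<open>Pairings of the Yang-Baxter terms\<close>

definition bilinear_product :: "('k::field \<Rightarrow> 'a::ab_group_add \<Rightarrow> 'a) \<Rightarrow> ('a \<Rightarrow> 'a \<Rightarrow> 'a) \<Rightarrow> bool"
  where "bilinear_product scale m \<longleftrightarrow>
    (\<forall>x. Vector_Spaces.linear scale scale (\<lambda>y. m x y)) \<and>
    (\<forall>y. Vector_Spaces.linear scale scale (\<lambda>x. m x y))"

lemma bilinear_productD:
  assumes "bilinear_product scale m"
  shows bilinear_add_left: "m (x + x') y = m x y + m x' y"
    and bilinear_add_right: "m x (y + y') = m x y + m x y'"
    and bilinear_neg_left: "m (- x) y = - m x y"
    and bilinear_neg_right: "m x (- y) = - m x y"
    and bilinear_scale_left: "m (scale c x) y = scale c (m x y)"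
    and bilinear_scale_right: "m x (scale c y) = scale c (m x y)"
    and bilinear_sum_left: "m (sum g K) y = (\<Sum>i\<in>K. m (g i) y)"
    and bilinear_sum_right: "m x (sum g K) = (\<Sum>i\<in>K. m x (g i))"
proof -
  interpret L: module_hom scale scale "\<lambda>x. m x y" for y
    using assms by (simp add: bilinear_product_def linear_iff_module_hom)
  interpret R: module_hom scale scale "m x" for x
    using assms by (simp add: bilinear_product_def linear_iff_module_hom)
  show "m (x + x') y = m x y + m x' y" "m x (y + y') = m x y + m x y'"
    "m (- x) y = - m x y" "m x (- y) = - m x y"
    "m (scale c x) y = scale c (m x y)" "m x (scale c y) = scale c (m x y)"
    "m (sum g K) y = (\<Sum>i\<in>K. m (g i) y)" "m x (sum g K) = (\<Sum>i\<in>K. m x (g i))"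
    by (rule L.add R.add L.neg R.neg L.scale R.scale L.sum R.sum)+
qed

lemma dual_bilinear_T_map:
  assumes "bilinear_product scale m" "w \<in> dual_space scale"
  shows "w (m (T_map scale I a b u) (T_map scale I c d v))
    = (\<Sum>i\<in>I. \<Sum>j\<in>I. u (a i) * v (c j) * w (m (b i) (d j)))"
  by (subst sum.swap) (simp add: T_map_def bilinear_productD[OF assms(1)] dual_spaceD[OF assms(2)]
      sum_distrib_left mult_ac)

text \<open>Each functional on an unmultiplied leg of \<open>r\<close> turns that copy of \<open>r\<close> into a vector: \<open>T\<close> if it
  hits the first leg \<open>a i\<close>, the transpose if it hits the second leg \<open>b i\<close>.\<close>

context
  fixes scale :: "'k::field \<Rightarrow> 'a::ab_group_add \<Rightarrow> 'a" and m :: "'a \<Rightarrow> 'a \<Rightarrow> 'a"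
    and w u v :: "'a \<Rightarrow> 'k"
  assumes m: "bilinear_product scale m"
    and dual: "w \<in> dual_space scale" "u \<in> dual_space scale" "v \<in> dual_space scale"
begin

lemma pairing_r12_r13:
  "pairing3 w u v (r12_r13 m I a b) = w (m (T_map scale I b a u) (T_map scale I b a v))"
  by (simp add: r12_r13_def lin_ext_simps vector_space_field dual_bilinear_T_map m dual mult_ac)

lemma pairing_r23_r12:
  "pairing3 w u v (r23_r12 m I a b) = u (m (T_map scale I b a v) (T_map scale I a b w))"
  unfolding dual_bilinear_T_map[OF m dual(2)]
  by (subst sum.swap) (simp add: r23_r12_def lin_ext_simps vector_space_field mult_ac)

lemma pairing_r13_r23:
  "pairing3 w u v (r13_r23 m I a b) = v (m (T_map scale I a b w) (T_map scale I a b u))"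
  by (simp add: r13_r23_def lin_ext_simps vector_space_field dual_bilinear_T_map m dual mult_ac)

end

section \<open>The equivalence\<close>

theorem theorem6p16:
  fixes scale :: "'k::field \<Rightarrow> 'a::ab_group_add \<Rightarrow> 'a"
    and succ prec :: "'a \<Rightarrow> 'a \<Rightarrow> 'a"
    and I :: "'i set" and a b :: "'i \<Rightarrow> 'a"
  assumes "anti_dendriform_algebra scale succ prec"
    and "finite I"
    and "skew_symmetric_tensor scale I a b"
  shows "anti_dendriform_YBE scale succ prec I a b \<longleftrightarrow>
    (\<forall>u\<in>dual_space scale. \<forall>v\<in>dual_space scale.
      assoc_prod succ prec (T_map scale I a b u) (T_map scale I a b v)
      + T_map scale I a b
          (\<lambda>x. dual_op (Rmult prec) (T_map scale I a b u) v x
             + dual_op (Lmult succ) (T_map scale I a b v) u x) = 0)"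
proof -
  interpret anti_dendriform_algebra scale succ prec by fact
  obtain B where "finite_dimensional_vector_space scale B"
    using finite_dimensional by blast
  then interpret FD: finite_dimensional_vector_space scale B .
  have succ: "bilinear_product scale succ" and prec: "bilinear_product scale prec"
    by (simp_all add: bilinear_product_def linear_succ_left linear_succ_right
        linear_prec_left linear_prec_right)
  have prod: "bilinear_product scale (assoc_prod succ prec)"
    unfolding bilinear_product_def
    by (intro conjI allI; rule Vector_Spaces.linear_iff[THEN iffD2];
        simp add: assoc_prod_def bilinear_productD[OF succ] bilinear_productD[OF prec]
          scale_right_distrib vector_space_axioms)
  let ?T = "T_map scale I a b"
  let ?f = "\<lambda>u v x. dual_op (Rmult prec) (?T u) v x + dual_op (Lmult succ) (?T v) u x"
  let ?lhs = "\<lambda>u v. assoc_prod succ prec (?T u) (?T v) + ?T (?f u v)"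
  let ?Y = "r12_r13 (assoc_prod succ prec) I a b + r23_r12 succ I a b - r13_r23 prec I a b"
  note skew = T_map_transpose_skew[OF vector_space_axioms assms(3)]
  have f_dual: "?f u v \<in> dual_space scale"
    if "u \<in> dual_space scale" "v \<in> dual_space scale" for u v
    unfolding dual_space_def mem_Collect_eq
    by (rule Vector_Spaces.linear_iff[THEN iffD2]) (auto simp: dual_op_def Rmult_def Lmult_def bilinear_productD[OF succ]
        bilinear_productD[OF prec] dual_spaceD[OF that(1)] dual_spaceD[OF that(2)]
        vector_space_axioms vector_space_field algebra_simps)
  have key: "pairing3 w u v ?Y = w (?lhs u v)"
    if w: "w \<in> dual_space scale" and u: "u \<in> dual_space scale" and v: "v \<in> dual_space scale"
    for w u v
  proof -
    have "pairing3 w u v ?Y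
        = w (assoc_prod succ prec (?T u) (?T v)) - u (succ (?T v) (?T w)) - v (prec (?T w) (?T u))"
      by (simp add: lin_ext_simps vector_space_field pairing_r12_r13[OF prod w u v]
          pairing_r23_r12[OF succ w u v] pairing_r13_r23[OF prec w u v]
          skew[OF w] skew[OF u] skew[OF v] bilinear_productD[OF prod]
          bilinear_productD[OF succ] dual_spaceD[OF u])
    \<comment> \<open>The signs are moved onto \<open>T w\<close>, since \<open>- T w\<close> is the transpose at \<open>w\<close>, the point at which
      \<open>dual_T_map\<close> evaluates the functional.\<close>
    also have "u (succ (?T v) (?T w)) = - u (succ (?T v) (- ?T w))"
      by (simp add: bilinear_productD[OF succ] dual_spaceD[OF u])
    also have "v (prec (?T w) (?T u)) = - v (prec (- ?T w) (?T u))"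
      by (simp add: bilinear_productD[OF prec] dual_spaceD[OF v])
    also have "w (assoc_prod succ prec (?T u) (?T v)) - - u (succ (?T v) (- ?T w))
          - - v (prec (- ?T w) (?T u))
        = w (assoc_prod succ prec (?T u) (?T v)) + ?f u v (- ?T w)"
      by (simp add: dual_op_def Rmult_def Lmult_def)
    also have "?f u v (- ?T w) = w (?T (?f u v))"
      using dual_T_map[OF f_dual[OF u v] w, of I a b, symmetric] by (simp only: skew[OF w])
    finally show ?thesis by (simp only: dual_add[OF w])
  qed
  have "anti_dendriform_YBE scale succ prec I a b \<longleftrightarrow>
      (\<forall>w\<in>dual_space scale. \<forall>u\<in>dual_space scale. \<forall>v\<in>dual_space scale. w (?lhs u v) = 0)"
    unfolding anti_dendriform_YBE_def FD.tensor3_zero_iff_pairings using key by simp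
  also have "\<dots> \<longleftrightarrow> (\<forall>u\<in>dual_space scale. \<forall>v\<in>dual_space scale. ?lhs u v = 0)"
  proof
    assume "\<forall>w\<in>dual_space scale. \<forall>u\<in>dual_space scale. \<forall>v\<in>dual_space scale. w (?lhs u v) = 0"
    then show "\<forall>u\<in>dual_space scale. \<forall>v\<in>dual_space scale. ?lhs u v = 0"
      by (intro ballI FD.functionals_separate) blast
  next
    assume "\<forall>u\<in>dual_space scale. \<forall>v\<in>dual_space scale. ?lhs u v = 0"
    then show "\<forall>w\<in>dual_space scale. \<forall>u\<in>dual_space scale. \<forall>v\<in>dual_space scale. w (?lhs u v) = 0"
      by (auto intro: dual_zero)
  qed
  finally show ?thesis .
qed

end
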